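(* Let $\Gamma$ and $\Lambda$ be finitely generated groups with volume growth functions $V_\Gamma$ and $V_\Lambda$. Assume that there exist two increasing functions $f_\Gamma$ and $f_\Lambda$ such that $f_\Gamma\approx V_\Gamma$, $f_\Lambda\approx V_\Lambda$, and, as $x\to+\infty$: (i) $f_\Gamma^{-1}(x)=o(f_\Lambda^{-1}(x))$; (ii) for every $C>0$, $f_\Gamma^{-1}(Cx)=O(f_\Gamma^{-1}(x))$; (iii) for every $C>0$, $f_\Gamma^{-1}\circ f_\Lambda(Cx)=O(f_\Gamma^{-1}\circ f_\Lambda(x))$. Then there is no $(f_\Gamma^{-1}\circ f_\Lambda,\mathrm{L}^0)$-integrable measure equivalence coupling from $\Gamma$ to $\Lambda$.
   Context: Asymptotic comparison: for non-decreasing real functions $f,g$ defined near $+\infty$, $f\preccurlyeq g$ means there is $C>0$ with $f(x)=O(g(Cx))$ as $x\to+\infty$; $f\approx g$ means $f\preccurlyeq g$ and $g\preccurlyeq f$. Volume growth: for a finite generating set $S_\Gamma$, $V_\Gamma(n)$ is the number of elements of $\Gamma$ that can be written as a product of $n$ elements of $S_\Gamma\cup S_\Gamma^{-1}\cup\{e\}$, extended to a continuous non-decreasing function on $\mathbb{R}_+$ (well defined up to $\approx$). Measure equivalence coupling between countable groups $\Gamma,\Lambda$: a quadruple $(\Omega,X_\Gamma,X_\Lambda,\mu)$ where $(\Omega,\mu)$ is a standard Borel measure space with commuting, free, measure-preserving actions $\gamma\ast x$, $\lambda\ast x$ of $\Gamma$ and $\Lambda$, and $X_\Gamma$ (resp.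 $X_\Lambda$) is a Borel fundamental domain of finite measure for the $\Gamma$-action (resp. $\Lambda$-action). For $\gamma\in\Gamma$ and $x\in X_\Lambda$, $\gamma\cdot x$ is the unique point of $(\Lambda\ast\gamma\ast x)\cap X_\Lambda$, and the cocycle $c_{\Lambda,\Gamma}\colon\Gamma\times X_\Lambda\to\Lambda$ is defined by $c_{\Lambda,\Gamma}(\gamma,x)\ast\gamma\ast x=\gamma\cdot x$; symmetrically one defines $c_{\Gamma,\Lambda}\colon\Lambda\times X_\Gamma\to\Gamma$. For a non-decreasing $\varphi\colon\mathbb{R}_+\to\mathbb{R}_+$, $c_{\Lambda,\Gamma}$ is $\varphi$-integrable if for every $\gamma\in\Gamma$ there is $c_\gamma>0$ with $\int_{X_\Lambda}\varphi(|c_{\Lambda,\Gamma}(\gamma,x)|_{S_\Lambda}/c_\gamma)\,d\mu(x)<+\infty$, where $|\cdot|_{S_\Lambda}$ is the word length for a finite generating set $S_\Lambda$ of $\Lambda$. A coupling is a $(\varphi,\mathrm{L}^0)$-integrable measure equivalence coupling from $\Gamma$ to $\Lambda$ if $c_{\Lambda,\Gamma}$ is $\varphi$-integrable (no requirement on $c_{\Gamma,\Lambda}$). *)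

theory Defs
  imports "HOL-Probability.Probability" "HOL-Algebra.Algebra" "HOL-Library.Landau_Symbols"
begin

primrec word_ball :: "('g, 'b) monoid_scheme \<Rightarrow> 'g set \<Rightarrow> nat \<Rightarrow> 'g set" where
  "word_ball G S 0 = {one G}"
| "word_ball G S (Suc n) =
     {mult G x s | x s. x \<in> word_ball G S n \<and> s \<in> S \<union> (m_inv G) ` S \<union> {one G}}"

definition word_length :: "('g, 'b) monoid_scheme \<Rightarrow> 'g set \<Rightarrow> 'g \<Rightarrow> nat" where
  "word_length G S g = (LEAST n. g \<in> word_ball G S n)"

definition fin_gen_set :: "('g, 'b) monoid_scheme \<Rightarrow> 'g set \<Rightarrow> bool" where
  "fin_gen_set G S \<longleftrightarrow> finite S \<and> S \<subseteq> carrier G \<and> generate G S = carrier G"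

text \<open>Volume growth on integers, extended piecewise linearly to a continuous
  non-decreasing function on the non-negative reals.\<close>
definition vol_nat :: "('g, 'b) monoid_scheme \<Rightarrow> 'g set \<Rightarrow> nat \<Rightarrow> real" where
  "vol_nat G S n = real (card (word_ball G S n))"

definition vol_growth :: "('g, 'b) monoid_scheme \<Rightarrow> 'g set \<Rightarrow> real \<Rightarrow> real" where
  "vol_growth G S x =
     (let n = nat \<lfloor>x\<rfloor>; t = x - real n in
        vol_nat G S n + t * (vol_nat G S (Suc n) - vol_nat G S n))"

definition asym_le :: "(real \<Rightarrow> real) \<Rightarrow> (real \<Rightarrow> real) \<Rightarrow> bool" where
  "asym_le f g \<longleftrightarrow> (\<exists>C>0. f \<in> O[at_top](\<lambda>x. g (C * x)))"

definition asym_eq :: "(real \<Rightarrow> real) \<Rightarrow> (real \<Rightarrow> real) \<Rightarrow> bool" where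
  "asym_eq f g \<longleftrightarrow> asym_le f g \<and> asym_le g f"

definition finv :: "(real \<Rightarrow> real) \<Rightarrow> real \<Rightarrow> real" where
  "finv f = inv_into {0..} f"

definition free_mp_action ::
  "('g, 'b) monoid_scheme \<Rightarrow> 'w measure \<Rightarrow> ('g \<Rightarrow> 'w \<Rightarrow> 'w) \<Rightarrow> bool" where
  "free_mp_action G M a \<longleftrightarrow>
     (\<forall>x \<in> space M. a (one G) x = x) \<and>
     (\<forall>g \<in> carrier G. \<forall>h \<in> carrier G. \<forall>x \<in> space M. a (mult G g h) x = a g (a h x)) \<and>
     (\<forall>g \<in> carrier G. a g \<in> measurable M M \<and> distr M M (a g) = M) \<and>
     (\<forall>g \<in> carrier G. \<forall>x \<in> space M. a g x = x \<longrightarrow> g = one G)"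

definition fund_domain ::
  "('g, 'b) monoid_scheme \<Rightarrow> 'w measure \<Rightarrow> ('g \<Rightarrow> 'w \<Rightarrow> 'w) \<Rightarrow> 'w set \<Rightarrow> bool" where
  "fund_domain G M a D \<longleftrightarrow> D \<in> sets M \<and> (emeasure M D < Orderings.top) \<and>
     (\<forall>x \<in> space M. \<exists>!g. g \<in> carrier G \<and> a g x \<in> D)"

text \<open>ME coupling (\<Omega>, X_G, X_L, \<mu>) between G and L, on a standard Borel space
  (a Polish space with its Borel sets).\<close>
definition me_coupling ::
  "('g, 'b) monoid_scheme \<Rightarrow> ('l, 'c) monoid_scheme \<Rightarrow> 'w::polish_space measure \<Rightarrow>
   ('g \<Rightarrow> 'w \<Rightarrow> 'w) \<Rightarrow> ('l \<Rightarrow> 'w \<Rightarrow> 'w) \<Rightarrow> 'w set \<Rightarrow> 'w set \<Rightarrow> bool" where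
  "me_coupling G L M aG aL XG XL \<longleftrightarrow>
     sets M = sets borel \<and>
     free_mp_action G M aG \<and> free_mp_action L M aL \<and>
     (\<forall>g \<in> carrier G. \<forall>l \<in> carrier L. \<forall>x \<in> space M. aG g (aL l x) = aL l (aG g x)) \<and>
     fund_domain G M aG XG \<and> fund_domain L M aL XL \<and>
     0 < emeasure M XL"

definition me_cocycle ::
  "('l, 'c) monoid_scheme \<Rightarrow> ('g \<Rightarrow> 'w \<Rightarrow> 'w) \<Rightarrow> ('l \<Rightarrow> 'w \<Rightarrow> 'w) \<Rightarrow> 'w set \<Rightarrow> 'g \<Rightarrow> 'w \<Rightarrow> 'l" where
  "me_cocycle L aG aL XL g x = (THE l. l \<in> carrier L \<and> aL l (aG g x) \<in> XL)"

definition phi_integrable_cocycle ::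
  "(real \<Rightarrow> real) \<Rightarrow> ('g, 'b) monoid_scheme \<Rightarrow> ('l, 'c) monoid_scheme \<Rightarrow> 'l set \<Rightarrow>
   'w measure \<Rightarrow> ('g \<Rightarrow> 'w \<Rightarrow> 'w) \<Rightarrow> ('l \<Rightarrow> 'w \<Rightarrow> 'w) \<Rightarrow> 'w set \<Rightarrow> bool" where
  "phi_integrable_cocycle \<phi> G L SL M aG aL XL \<longleftrightarrow>
     (\<forall>g \<in> carrier G. \<exists>c>0.
        (\<integral>\<^sup>+ x \<in> XL. ennreal (\<phi> (real (word_length L SL (me_cocycle L aG aL XL g x)) / c)) \<partial>M) < Orderings.top)"

definition phi_L0_coupling ::
  "(real \<Rightarrow> real) \<Rightarrow> ('g, 'b) monoid_scheme \<Rightarrow> ('l, 'c) monoid_scheme \<Rightarrow> 'l set \<Rightarrow>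
   'w::polish_space measure \<Rightarrow> ('g \<Rightarrow> 'w \<Rightarrow> 'w) \<Rightarrow> ('l \<Rightarrow> 'w \<Rightarrow> 'w) \<Rightarrow> 'w set \<Rightarrow> 'w set \<Rightarrow> bool" where
  "phi_L0_coupling \<phi> G L SL M aG aL XG XL \<longleftrightarrow>
     me_coupling G L M aG aL XG XL \<and> phi_integrable_cocycle \<phi> G L SL M aG aL XL"

end

theory Submission
  imports Defs
begin

text \<open>Write \<open>\<phi> = f\<^sub>\<Gamma>\<^sup>-\<^sup>1 \<circ> f\<^sub>\<Lambda>\<close>, so that \<open>\<phi> x = o(x)\<close>. The group \<open>\<Gamma>\<close> acts on \<open>X\<^sub>\<Lambda>\<close> preserving
  its finite measure, so by the cocycle identity a bounded subadditive function of the cocycle at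
  a word of length \<open>n\<close> has mean at most \<open>n\<close> times the largest mean at a generator. Apply this to
  the word length truncated at a scale \<open>R\<close>. Along a sequence of scales at which \<open>\<phi> x / x\<close> is nearly
  a running minimum, \<open>\<phi>\<close>-integrability and dominated convergence make the truncated means at the
  generators \<open>o(R / \<phi> R)\<close>. Hence for every \<open>C\<close> there are arbitrarily large \<open>R\<close> such that, by
  Markov's inequality, each element of the \<open>\<Gamma>\<close>-ball of radius \<open>C \<phi>(R)\<close> has cocycle of length
  \<open>O(R)\<close> outside a set of small measure.

  A translate of \<open>X\<^sub>\<Gamma>\<close> meets \<open>X\<^sub>\<Lambda>\<close> in a set \<open>A\<close> of positive measure, and every \<open>\<Gamma>\<close>-orbit meets
  \<open>A\<close> at most once. As the actions commute, the elements \<open>\<gamma>\<close> with \<open>\<gamma> \<cdot> x \<in> A\<close> are therefore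
  determined by their cocycle at \<open>x\<close>. Counting them gives \<open>V\<^sub>\<Gamma>(C \<phi>(R)) \<le> K V\<^sub>\<Lambda>(c R)\<close> with \<open>K\<close> and
  \<open>c\<close> independent of \<open>C\<close>; applying \<open>f\<^sub>\<Gamma>\<^sup>-\<^sup>1\<close> and the two doubling hypotheses bounds \<open>C\<close>, a
  contradiction.\<close>

section \<open>Word balls\<close>

context group
begin

abbreviation letters :: "'a set \<Rightarrow> 'a set" where
  "letters S \<equiv> S \<union> m_inv G ` S \<union> {\<one>}"

lemma letters_subset_carrier: "S \<subseteq> carrier G \<Longrightarrow> letters S \<subseteq> carrier G"
  by auto

lemma word_ball_subset_carrier:
  assumes "S \<subseteq> carrier G"
  shows "word_ball G S n \<subseteq> carrier G"
proof (induction n)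
  case (Suc n)
  then show ?case using letters_subset_carrier[OF assms] by auto
qed simp

lemma finite_word_ball:
  assumes "finite S"
  shows "finite (word_ball G S n)"
proof (induction n)
  case (Suc n)
  have "word_ball G S (Suc n) = (\<lambda>(x, s). x \<otimes> s) ` (word_ball G S n \<times> letters S)"
    by auto
  also have "finite \<dots>" using Suc assms by simp
  finally show ?case .
qed simp

lemma word_ball_mono:
  assumes "S \<subseteq> carrier G" "m \<le> n"
  shows "word_ball G S m \<subseteq> word_ball G S n"
proof -
  have "word_ball G S k \<subseteq> word_ball G S (Suc k)" for k
  proof
    fix x assume x: "x \<in> word_ball G S k"
    then have "x = x \<otimes> \<one>" using word_ball_subset_carrier[OF assms(1)] by fastforce
    with x show "x \<in> word_ball G S (Suc k)" by auto
  qed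
  then show ?thesis using assms(2) by (rule lift_Suc_mono_le)
qed

lemma word_ball_mult:
  assumes S: "S \<subseteq> carrier G" and x: "x \<in> word_ball G S m" and y: "y \<in> word_ball G S n"
  shows "x \<otimes> y \<in> word_ball G S (m + n)"
  using y
proof (induction n arbitrary: y)
  case 0
  then show ?case using x word_ball_subset_carrier[OF S] by fastforce
next
  case (Suc n)
  then obtain z s where y_eq: "y = z \<otimes> s" and z: "z \<in> word_ball G S n" and s: "s \<in> letters S"
    by auto
  have "x \<otimes> y = (x \<otimes> z) \<otimes> s"
    using y_eq x z s word_ball_subset_carrier[OF S] letters_subset_carrier[OF S]
    by (metis m_assoc subsetD)
  then show ?case using Suc.IH[OF z] s by auto
qed

lemma letters_subset_word_ball:
  assumes "S \<subseteq> carrier G"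
  shows "letters S \<subseteq> word_ball G S 1"
proof
  fix s assume s: "s \<in> letters S"
  then have "s = \<one> \<otimes> s" using letters_subset_carrier[OF assms] by auto
  then show "s \<in> word_ball G S 1" using s by auto
qed

lemma generate_subset_Union_word_ball:
  assumes S: "S \<subseteq> carrier G"
  shows "generate G S \<subseteq> (\<Union>n. word_ball G S n)"
proof
  fix x assume "x \<in> generate G S"
  then show "x \<in> (\<Union>n. word_ball G S n)"
  proof induction
    case one
    show ?case by (intro UN_I[of 0]) simp_all
  next
    case (incl h)
    then show ?case using letters_subset_word_ball[OF S] by blast
  next
    case (inv h)
    then show ?case using letters_subset_word_ball[OF S] by blast
  next
    case (eng h1 h2)
    then show ?case using word_ball_mult[OF S] by blast
  qed
qed

lemma word_length_le: "x \<in> word_ball G S n \<Longrightarrow> word_length G S x \<le> n"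
  unfolding word_length_def by (rule Least_le)

lemma word_length_one [simp]: "word_length G S \<one> = 0"
  using word_length_le[of \<one> S 0] by simp

end

locale fin_gen_group = group G for G (structure) +
  fixes S
  assumes fin_gen: "fin_gen_set G S"
begin

lemma finite_gens: "finite S" and gens_subset_carrier: "S \<subseteq> carrier G"
  using fin_gen by (simp_all add: fin_gen_set_def)

lemma carrier_eq_Union_word_ball: "carrier G = (\<Union>n. word_ball G S n)"
proof
  show "carrier G \<subseteq> (\<Union>n. word_ball G S n)"
    using fin_gen generate_subset_Union_word_ball[of S] by (auto simp: fin_gen_set_def)
  show "(\<Union>n. word_ball G S n) \<subseteq> carrier G"
    using word_ball_subset_carrier[OF gens_subset_carrier] by blast
qed

lemma countable_carrier: "countable (carrier G)"
  unfolding carrier_eq_Union_word_ball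
  by (simp add: countable_finite finite_word_ball finite_gens)

lemma in_word_ball_iff:
  assumes "x \<in> carrier G"
  shows "x \<in> word_ball G S n \<longleftrightarrow> word_length G S x \<le> n"
proof -
  have "\<exists>n. x \<in> word_ball G S n" using assms carrier_eq_Union_word_ball by blast
  then have "x \<in> word_ball G S (word_length G S x)"
    unfolding word_length_def by (rule LeastI_ex)
  then show ?thesis
    using word_length_le word_ball_mono[OF gens_subset_carrier] by blast
qed

lemma word_length_mult_le:
  assumes "x \<in> carrier G" "y \<in> carrier G"
  shows "word_length G S (x \<otimes> y) \<le> word_length G S x + word_length G S y"
  by (intro word_length_le word_ball_mult gens_subset_carrier)
    (simp_all add: assms in_word_ball_iff)

lemma vol_nat_mono: "m \<le> n \<Longrightarrow> vol_nat G S m \<le> vol_nat G S n"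
  unfolding vol_nat_def
  by (intro of_nat_mono card_mono finite_word_ball word_ball_mono finite_gens gens_subset_carrier)

lemma vol_nat_floor_le_vol_growth:
  assumes "0 \<le> x"
  shows "vol_nat G S (nat \<lfloor>x\<rfloor>) \<le> vol_growth G S x"
  using vol_nat_mono[of "nat \<lfloor>x\<rfloor>" "Suc (nat \<lfloor>x\<rfloor>)"] assms
  unfolding vol_growth_def Let_def by simp

lemma vol_growth_le_vol_nat_ceiling:
  assumes "0 \<le> x"
  shows "vol_growth G S x \<le> vol_nat G S (nat \<lceil>x\<rceil>)"
proof (cases "x = real (nat \<lfloor>x\<rfloor>)")
  case True
  then have "nat \<lceil>x\<rceil> = nat \<lfloor>x\<rfloor>" by linarith
  with True show ?thesis unfolding vol_growth_def Let_def by simp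
next
  case False
  let ?n = "nat \<lfloor>x\<rfloor>"
  have ceiling: "nat \<lceil>x\<rceil> = Suc ?n" using False assms by linarith
  have "(x - real ?n) * (vol_nat G S (Suc ?n) - vol_nat G S ?n)
      \<le> 1 * (vol_nat G S (Suc ?n) - vol_nat G S ?n)"
    using assms vol_nat_mono[of ?n "Suc ?n"] by (intro mult_right_mono) linarith+
  then show ?thesis unfolding vol_growth_def Let_def ceiling by simp
qed

lemma vol_growth_nonneg: "0 \<le> x \<Longrightarrow> 0 \<le> vol_growth G S x"
  using vol_nat_floor_le_vol_growth[of x] by (simp add: vol_nat_def)

end

section \<open>Growth functions and their inverses\<close>

locale growth_function =
  fixes f :: "real \<Rightarrow> real" and b :: real
  assumes strict_mono: "strict_mono_on {0..} f"
    and onto: "{b..} \<subseteq> f ` {0..}"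
begin

lemma finv_f: "0 \<le> x \<Longrightarrow> finv f (f x) = x"
  unfolding finv_def using strict_mono_on_imp_inj_on[OF strict_mono] by (intro inv_into_f_f) auto

lemma f_finv: "b \<le> y \<Longrightarrow> f (finv f y) = y"
  unfolding finv_def using onto by (intro f_inv_into_f) auto

lemma finv_nonneg: "b \<le> y \<Longrightarrow> 0 \<le> finv f y"
  using inv_into_into[of y f "{0..}"] onto unfolding finv_def by auto

lemma le_finvI:
  assumes "0 \<le> x" "f x \<le> y" "b \<le> y"
  shows "x \<le> finv f y"
proof (rule ccontr)
  assume "\<not> x \<le> finv f y"
  then have "f (finv f y) < f x"
    using assms finv_nonneg[of y] by (intro strict_mono_onD[OF strict_mono]) auto
  then show False using assms f_finv by simp
qed

lemma finv_mono: "b \<le> y \<Longrightarrow> y \<le> z \<Longrightarrow> finv f y \<le> finv f z"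
  by (rule le_finvI) (simp_all add: finv_nonneg f_finv)

lemma filterlim_finv_at_top: "filterlim (finv f) at_top at_top"
  unfolding filterlim_at_top
proof
  fix Z
  show "\<forall>\<^sub>F y in at_top. Z \<le> finv f y"
    using eventually_ge_at_top[of "max b (f (max 0 Z))"]
  proof eventually_elim
    case (elim y)
    then have "max 0 Z \<le> finv f y" by (intro le_finvI) auto
    then show ?case by simp
  qed
qed

lemma filterlim_growth_at_top: "filterlim f at_top at_top"
  unfolding filterlim_at_top
proof
  fix Z
  define x where "x = finv f (max b Z)"
  have x: "0 \<le> x" "f x = max b Z" by (simp_all add: x_def finv_nonneg f_finv)
  show "\<forall>\<^sub>F y in at_top. Z \<le> f y"
    using eventually_ge_at_top[of x]
  proof eventually_elim
    case (elim y)
    then have "f x \<le> f y" using x by (intro strict_mono_on_leD[OF strict_mono]) auto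
    then show ?case using x by simp
  qed
qed

end

lemma filterlim_mult_const_at_top: "0 < c \<Longrightarrow> filterlim (\<lambda>x::real. c * x) at_top at_top"
  by (simp add: filterlim_tendsto_pos_mult_at_top[OF tendsto_const _ filterlim_ident])

lemma asym_leE:
  assumes "asym_le f g"
  obtains A C where "0 < A" "0 < C" "\<forall>\<^sub>F x in at_top. \<bar>f x\<bar> \<le> A * \<bar>g (C * x)\<bar>"
  using assms unfolding asym_le_def by (auto elim: landau_o.bigE)

locale growth_function_pair =
  dom: growth_function f a + cod: growth_function g b
  for f :: "real \<Rightarrow> real" and a :: real and g :: "real \<Rightarrow> real" and b :: real
begin

abbreviation rate :: "real \<Rightarrow> real" where
  "rate x \<equiv> finv f (g x)"

lemma filterlim_rate_at_top: "filterlim rate at_top at_top"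
  by (rule filterlim_compose[OF dom.filterlim_finv_at_top cod.filterlim_growth_at_top])

lemma rate_smallo_ident:
  assumes "finv f \<in> o[at_top](finv g)"
  shows "rate \<in> o[at_top](\<lambda>x. x)"
proof -
  have "rate \<in> o[at_top](\<lambda>x. finv g (g x))"
    by (rule landau_o.small.compose[OF assms cod.filterlim_growth_at_top])
  moreover have "\<forall>\<^sub>F x in at_top. finv g (g x) = x"
    using eventually_ge_at_top[of 0] by eventually_elim (rule cod.finv_f)
  then have "(\<lambda>x. finv g (g x)) \<in> \<Theta>[at_top](\<lambda>x. x)" by (rule bigthetaI_cong)
  ultimately show ?thesis by (simp only: landau_o.small.cong_bigtheta)
qed

lemma ex_mono_on_rate:
  obtains T where "0 < T" "0 < rate T" "mono_on {T..} rate"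
proof -
  have "\<forall>\<^sub>F x in at_top. a \<le> g x"
    using cod.filterlim_growth_at_top unfolding filterlim_at_top by (rule spec)
  moreover have "\<forall>\<^sub>F x in at_top. 0 < rate x"
    using filterlim_rate_at_top unfolding filterlim_at_top_dense by (rule spec)
  ultimately have "\<forall>\<^sub>F x in at_top. 0 < x \<and> a \<le> g x \<and> 0 < rate x"
    by (intro eventually_conj eventually_gt_at_top)
  then obtain T where T: "0 < T" "a \<le> g T" "0 < rate T"
    unfolding eventually_at_top_linorder by blast
  have "mono_on {T..} rate"
  proof (rule mono_onI)
    fix x y assume "x \<in> {T..}" "y \<in> {T..}" "x \<le> y"
    then have "g T \<le> g x" "g x \<le> g y"
      using T by (auto intro!: strict_mono_on_leD[OF cod.strict_mono])
    then show "rate x \<le> rate y" using T by (intro dom.finv_mono) auto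
  qed
  with T show ?thesis using that by blast
qed

lemma finv_mult_growth_bigo_rate:
  assumes doubling_finv: "\<forall>C>0. (\<lambda>x. finv f (C * x)) \<in> O[at_top](finv f)"
    and doubling_rate: "\<forall>C>0. (\<lambda>x. rate (C * x)) \<in> O[at_top](rate)"
    and "0 < B" "0 < c"
  shows "(\<lambda>x. finv f (B * g (c * x))) \<in> O[at_top](rate)"
proof -
  have "(\<lambda>y. finv f (B * y)) \<in> O[at_top](finv f)"
    using doubling_finv \<open>0 < B\<close> by blast
  moreover have "filterlim (\<lambda>x. g (c * x)) at_top at_top"
    using cod.filterlim_growth_at_top filterlim_mult_const_at_top[OF \<open>0 < c\<close>]
    by (rule filterlim_compose)
  ultimately have "(\<lambda>x. finv f (B * g (c * x))) \<in> O[at_top](\<lambda>x. rate (c * x))"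
    by (rule landau_o.big.compose)
  also have "(\<lambda>x. rate (c * x)) \<in> O[at_top](rate)"
    using doubling_rate \<open>0 < c\<close> by blast
  finally show ?thesis .
qed

lemma ex_le_finv_if_growth_le:
  fixes V W :: "real \<Rightarrow> real"
  assumes V: "asym_le f V" and W: "asym_le W g" and V_nonneg: "\<And>x. 0 \<le> x \<Longrightarrow> 0 \<le> V x"
    and K: "0 < K" and c: "0 < c"
  obtains B C C' y\<^sub>0 where "0 < B" "0 < C" "0 < C'"
    "\<forall>\<^sub>F x in at_top. \<forall>y\<ge>y\<^sub>0. V (C * y) \<le> K * W (c * x) \<longrightarrow> y \<le> finv f (B * g (C' * x))"
proof -
  obtain A\<^sub>V C where A\<^sub>V: "0 < A\<^sub>V" and C: "0 < C"
    and "\<forall>\<^sub>F y in at_top. \<bar>f y\<bar> \<le> A\<^sub>V * \<bar>V (C * y)\<bar>"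
    using V by (rule asym_leE)
  then obtain y\<^sub>V where f_le: "\<And>y. y\<^sub>V \<le> y \<Longrightarrow> \<bar>f y\<bar> \<le> A\<^sub>V * \<bar>V (C * y)\<bar>"
    by (auto simp: eventually_at_top_linorder)
  obtain A\<^sub>W D where A\<^sub>W: "0 < A\<^sub>W" and D: "0 < D"
    and W_le: "\<forall>\<^sub>F x in at_top. \<bar>W x\<bar> \<le> A\<^sub>W * \<bar>g (D * x)\<bar>"
    using W by (rule asym_leE)
  define B where "B = A\<^sub>V * K * A\<^sub>W"
  have B: "0 < B" using A\<^sub>V K A\<^sub>W by (simp add: B_def)
  have "filterlim (\<lambda>x. g (D * c * x)) at_top at_top"
    using cod.filterlim_growth_at_top filterlim_mult_const_at_top[of "D * c"] D c
    by (auto intro: filterlim_compose)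
  then have "\<forall>\<^sub>F x in at_top. max 0 (a / B) \<le> g (D * c * x)"
    unfolding filterlim_at_top by (rule spec)
  with eventually_compose_filterlim[OF W_le filterlim_mult_const_at_top[OF c]]
  have "\<forall>\<^sub>F x in at_top. \<forall>y\<ge>max 0 y\<^sub>V.
      V (C * y) \<le> K * W (c * x) \<longrightarrow> y \<le> finv f (B * g (D * c * x))"
  proof (eventually_elim, intro allI impI)
    fix x y
    assume W_x: "\<bar>W (c * x)\<bar> \<le> A\<^sub>W * \<bar>g (D * (c * x))\<bar>" and g_x: "max 0 (a / B) \<le> g (D * c * x)"
      and y: "max 0 y\<^sub>V \<le> y" and V_le_W: "V (C * y) \<le> K * W (c * x)"
    have "f y \<le> A\<^sub>V * V (C * y)" using f_le[of y] y C V_nonneg[of "C * y"] by simp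
    also have "\<dots> \<le> A\<^sub>V * (K * (A\<^sub>W * \<bar>g (D * (c * x))\<bar>))"
    proof (rule mult_left_mono)
      have "K * W (c * x) \<le> K * (A\<^sub>W * \<bar>g (D * (c * x))\<bar>)"
        using W_x K by (intro mult_left_mono) auto
      with V_le_W show "V (C * y) \<le> K * (A\<^sub>W * \<bar>g (D * (c * x))\<bar>)" by simp
    qed (use A\<^sub>V in simp)
    also have "\<dots> = B * g (D * c * x)" using g_x by (simp add: B_def mult_ac)
    finally show "y \<le> finv f (B * g (D * c * x))"
      using g_x y B by (intro dom.le_finvI) (auto simp: field_simps)
  qed
  moreover have "0 < D * c" using D c by simp
  ultimately show ?thesis using that B C by blast
qed

lemma ex_eventually_growth_gap:
  fixes V W :: "real \<Rightarrow> real"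
  assumes V: "asym_le f V" and W: "asym_le W g" and V_nonneg: "\<And>x. 0 \<le> x \<Longrightarrow> 0 \<le> V x"
    and doubling_finv: "\<forall>C>0. (\<lambda>x. finv f (C * x)) \<in> O[at_top](finv f)"
    and doubling_rate: "\<forall>C>0. (\<lambda>x. rate (C * x)) \<in> O[at_top](rate)"
    and K: "0 < K" and c: "0 < c"
  obtains C where "0 < C" "\<forall>\<^sub>F x in at_top. K * W (c * x) < V (C * rate x)"
proof -
  obtain B C C' y\<^sub>0 where B: "0 < B" and C: "0 < C" and C': "0 < C'"
    and le_finv: "\<forall>\<^sub>F x in at_top. \<forall>y\<ge>y\<^sub>0.
      V (C * y) \<le> K * W (c * x) \<longrightarrow> y \<le> finv f (B * g (C' * x))"
    by (rule ex_le_finv_if_growth_le[OF V W V_nonneg K c])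
  obtain D where D: "0 < D"
    and finv_le: "\<forall>\<^sub>F x in at_top. \<bar>finv f (B * g (C' * x))\<bar> \<le> D * \<bar>rate x\<bar>"
    using finv_mult_growth_bigo_rate[OF doubling_finv doubling_rate B C']
    by (auto elim: landau_o.bigE)
  have "filterlim (\<lambda>x. (D + 1) * rate x) at_top at_top"
    using D
    by (intro filterlim_compose[OF filterlim_mult_const_at_top filterlim_rate_at_top]) simp
  then have "\<forall>\<^sub>F x in at_top. y\<^sub>0 \<le> (D + 1) * rate x"
    unfolding filterlim_at_top by (rule spec)
  moreover have "\<forall>\<^sub>F x in at_top. 0 < rate x"
    using filterlim_rate_at_top unfolding filterlim_at_top_dense by (rule spec)
  ultimately have "\<forall>\<^sub>F x in at_top. K * W (c * x) < V (C * ((D + 1) * rate x))"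
    using le_finv finv_le
  proof eventually_elim
    case (elim x)
    have "finv f (B * g (C' * x)) < (D + 1) * rate x"
      using elim(2,4) by (simp add: algebra_simps)
    then show ?case using elim(1,3) by (meson not_less)
  qed
  with that[of "C * (D + 1)"] C D show ?thesis by (simp add: mult_ac)
qed

end

section \<open>Truncated means\<close>

lemma ex_near_running_minimum:
  fixes q :: "real \<Rightarrow> real"
  assumes lim: "(q \<longlongrightarrow> 0) at_top"
    and lower: "\<And>y. T \<le> y \<Longrightarrow> \<exists>\<delta>>0. \<forall>x\<in>{T..y}. \<delta> \<le> q x"
    and \<kappa>: "1 < \<kappa>"
  obtains R where "N \<le> R" "T \<le> R" "\<And>x. x \<in> {T..R} \<Longrightarrow> q R \<le> \<kappa> * q x"
proof -
  define N' where "N' = max N T"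
  obtain \<delta> where \<delta>: "0 < \<delta>" "\<And>x. x \<in> {T..N'} \<Longrightarrow> \<delta> \<le> q x"
    using lower[of N'] by (auto simp: N'_def)
  have "\<forall>\<^sub>F x in at_top. N' \<le> x \<and> q x < \<delta>"
    using eventually_ge_at_top order_tendstoD(2)[OF lim \<delta>(1)] by (rule eventually_conj)
  then obtain R' where R': "N' \<le> R'" "q R' < \<delta>"
    unfolding eventually_at_top_linorder by blast
  then have "T \<le> R'" by (simp add: N'_def)
  then obtain \<delta>' where \<delta>': "0 < \<delta>'" "\<And>x. x \<in> {T..R'} \<Longrightarrow> \<delta>' \<le> q x"
    using lower by blast
  define m where "m = Inf (q ` {T..R'})"
  have bdd: "bdd_below (q ` {T..R'})" and nonempty: "q ` {T..R'} \<noteq> {}"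
    using \<delta>'(2) \<open>T \<le> R'\<close> by (auto intro: bdd_belowI2[of _ \<delta>'])
  have m_le: "m \<le> q x" if "x \<in> {T..R'}" for x
    unfolding m_def using bdd that by (intro cInf_lower) auto
  have "\<delta>' \<le> m" unfolding m_def using \<delta>'(2) nonempty by (intro cInf_greatest) auto
  then have "m < \<kappa> * m" using \<delta>'(1) \<kappa> by simp
  moreover have "m < \<delta>" using m_le[of R'] \<open>T \<le> R'\<close> R'(2) by simp
  ultimately obtain R where R: "R \<in> {T..R'}" "q R < \<kappa> * m" "q R < \<delta>"
    using cInf_lessD[OF nonempty, of "min (\<kappa> * m) \<delta>"] by (auto simp: m_def)
  show ?thesis
  proof
    show "N \<le> R" using \<delta>(2)[of R] R(1,3) by (fastforce simp: N'_def)
    show "T \<le> R" using R(1) by simp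
    show "q R \<le> \<kappa> * q x" if "x \<in> {T..R}" for x
    proof -
      have "\<kappa> * m \<le> \<kappa> * q x" using that R(1) m_le[of x] \<kappa> by (intro mult_left_mono) auto
      then show ?thesis using R(2) by simp
    qed
  qed
qed

text \<open>No concavity of \<open>\<phi>\<close> is available: at a scale \<open>R\<close> where \<open>\<phi> x / x\<close> is close to its minimum over
  \<open>[T, R]\<close>, the function \<open>2 \<phi>\<close> nevertheless dominates the linear function through \<open>(R, \<phi> R)\<close>
  truncated at \<open>R\<close>.\<close>

lemma ex_truncation_scales:
  fixes \<phi> :: "real \<Rightarrow> real"
  assumes mono: "mono_on {T..} \<phi>" and T: "0 < T" "0 < \<phi> T" and small: "\<phi> \<in> o[at_top](\<lambda>x. x)"
  obtains R :: "nat \<Rightarrow> real" where "filterlim R at_top sequentially" "\<And>k. T \<le> R k"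
    "\<And>k y. T \<le> y \<Longrightarrow> \<phi> (R k) / R k * min y (R k) \<le> 2 * \<phi> y"
proof -
  have lower: "\<exists>\<delta>>0. \<forall>x\<in>{T..y}. \<delta> \<le> \<phi> x / x" if "T \<le> y" for y
  proof (intro exI conjI ballI)
    show "0 < \<phi> T / y" using T that by simp
    show "\<phi> T / y \<le> \<phi> x / x" if "x \<in> {T..y}" for x
      using that T mono_onD[OF mono, of T x] by (intro frac_le) auto
  qed
  have "\<exists>R. real k \<le> R \<and> T \<le> R \<and> (\<forall>x\<in>{T..R}. \<phi> R / R \<le> 2 * (\<phi> x / x))" for k :: nat
    using smalloD_tendsto[OF small] lower
    by (rule ex_near_running_minimum[where \<kappa> = 2 and N = "real k"]) auto
  then obtain R where R: "\<And>k. real k \<le> R k" "\<And>k. T \<le> R k"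
    and near_min: "\<And>k x. x \<in> {T..R k} \<Longrightarrow> \<phi> (R k) / R k \<le> 2 * (\<phi> x / x)"
    by metis
  show ?thesis
  proof
    show "filterlim R at_top sequentially"
      using filterlim_real_sequentially by (rule filterlim_at_top_mono) (simp add: R(1))
    show "T \<le> R k" for k by (rule R(2))
    show "\<phi> (R k) / R k * min y (R k) \<le> 2 * \<phi> y" if y: "T \<le> y" for k y
    proof (cases "y \<le> R k")
      case True
      then have "\<phi> (R k) / R k * y \<le> 2 * (\<phi> y / y) * y"
        using near_min[of y k] y T by (intro mult_right_mono) auto
      then show ?thesis using True y T by simp
    next
      case False
      then show ?thesis
        using R(2)[of k] T mono_onD[OF mono, of T "R k"] mono_onD[OF mono, of "R k" y] by simp
    qed
  qed
qed

context finite_measure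
begin

lemma truncated_mean_tendsto_0:
  fixes Y :: "'a \<Rightarrow> real"
  assumes Y [measurable]: "Y \<in> borel_measurable M" and Y_nonneg: "\<And>x. x \<in> space M \<Longrightarrow> 0 \<le> Y x"
    and integrable: "integrable M (\<lambda>x. indicator {T..} (Y x) * w (Y x))"
    and slope: "r \<longlonglongrightarrow> 0" "\<And>k. 0 \<le> r k" and scale: "0 \<le> T" "\<And>k. T \<le> R k"
    and dominated: "\<And>k y. T \<le> y \<Longrightarrow> r k * min y (R k) \<le> w y"
  shows "(\<lambda>k. r k * (\<integral>x. min (Y x) (R k) \<partial>M)) \<longlonglongrightarrow> 0"
proof -
  have "(\<lambda>k. \<integral>x. r k * min (Y x) (R k) \<partial>M) \<longlonglongrightarrow> (\<integral>x. 0 \<partial>M)"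
  proof (rule integral_dominated_convergence)
    show "integrable M (\<lambda>x. indicator {T..} (Y x) * w (Y x) + w T)"
      using integrable by simp
    show "AE x in M. (\<lambda>k. r k * min (Y x) (R k)) \<longlonglongrightarrow> 0"
    proof (rule AE_I2, rule tendsto_sandwich)
      fix x assume x: "x \<in> space M"
      show "\<forall>\<^sub>F k in sequentially. 0 \<le> r k * min (Y x) (R k)"
        using Y_nonneg[OF x] slope(2) scale by (intro always_eventually allI mult_nonneg_nonneg)
          (auto intro: order_trans)
      show "\<forall>\<^sub>F k in sequentially. r k * min (Y x) (R k) \<le> r k * Y x"
        using slope(2) by (intro always_eventually allI mult_left_mono) auto
      show "(\<lambda>k. r k * Y x) \<longlonglongrightarrow> 0" using slope(1) by (rule tendsto_mult_left_zero)
    qed simp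
    fix k
    show "AE x in M. norm (r k * min (Y x) (R k)) \<le> indicator {T..} (Y x) * w (Y x) + w T"
    proof (rule AE_I2)
      fix x assume x: "x \<in> space M"
      have at_T: "r k * T \<le> w T" using dominated[of T k] scale(2)[of k] by simp
      have "0 \<le> r k * T" using slope(2) scale(1) by simp
      moreover have "r k * min (Y x) (R k) \<le> r k * T" if "Y x < T"
        using that slope(2) by (intro mult_left_mono) auto
      ultimately have "r k * min (Y x) (R k) \<le> indicator {T..} (Y x) * w (Y x) + w T"
        using dominated[of "Y x" k] at_T by (cases "T \<le> Y x") auto
      moreover have "0 \<le> r k * min (Y x) (R k)"
        using Y_nonneg[OF x] slope(2)[of k] scale(1) scale(2)[of k] by simp
      ultimately show "norm (r k * min (Y x) (R k)) \<le> indicator {T..} (Y x) * w (Y x) + w T"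
        by simp
    qed
  qed measurable
  then show ?thesis by simp
qed

lemma frequently_truncated_means_le:
  fixes Y :: "'s \<Rightarrow> 'a \<Rightarrow> real" and \<phi> :: "real \<Rightarrow> real"
  assumes S: "finite S" and Y: "\<And>s. s \<in> S \<Longrightarrow> Y s \<in> borel_measurable M" "\<And>s x. 0 \<le> Y s x"
    and integrable: "\<And>s. s \<in> S \<Longrightarrow> integrable M (\<lambda>x. indicator {T..} (Y s x) * \<phi> (Y s x))"
    and mono: "mono_on {T..} \<phi>" and T: "0 < T" "0 < \<phi> T" and small: "\<phi> \<in> o[at_top](\<lambda>x. x)"
    and \<epsilon>: "0 < \<epsilon>"
  shows "\<exists>\<^sub>F R in at_top. T \<le> R \<and> (\<forall>s\<in>S. (\<integral>x. min (Y s x) R \<partial>M) \<le> \<epsilon> * R / \<phi> R)"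
proof -
  obtain R :: "nat \<Rightarrow> real" where R_top: "filterlim R at_top sequentially" and T_le: "\<And>k. T \<le> R k"
    and dominated: "\<And>k y. T \<le> y \<Longrightarrow> \<phi> (R k) / R k * min y (R k) \<le> 2 * \<phi> y"
    using ex_truncation_scales[OF mono T small] by blast
  have \<phi>_pos: "0 < \<phi> (R k)" for k using T T_le[of k] mono_onD[OF mono, of T "R k"] by simp
  have R_pos: "0 < R k" for k using T(1) T_le[of k] by simp
  have "\<forall>\<^sub>F k in sequentially. \<forall>s\<in>S. (\<integral>x. min (Y s x) (R k) \<partial>M) \<le> \<epsilon> * R k / \<phi> (R k)"
  proof (rule eventually_ball_finite[OF S], rule ballI)
    fix s assume s: "s \<in> S"
    have "integrable M (\<lambda>x. indicator {T..} (Y s x) * (2 * \<phi> (Y s x)))"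
      using integrable_mult_right[OF integrable[OF s], of 2] by (simp add: mult.left_commute)
    moreover have "(\<lambda>k. \<phi> (R k) / R k) \<longlonglongrightarrow> 0"
      using smalloD_tendsto[OF small] R_top by (rule filterlim_compose)
    ultimately have "(\<lambda>k. \<phi> (R k) / R k * (\<integral>x. min (Y s x) (R k) \<partial>M)) \<longlonglongrightarrow> 0"
      using Y s T(1) T_le \<phi>_pos R_pos dominated
      by (intro truncated_mean_tendsto_0[where T = T and w = "\<lambda>y. 2 * \<phi> y"])
        (auto simp: less_imp_le)
    then have "\<forall>\<^sub>F k in sequentially. \<phi> (R k) / R k * (\<integral>x. min (Y s x) (R k) \<partial>M) < \<epsilon>"
      using \<epsilon> by (rule order_tendstoD(2))
    then show "\<forall>\<^sub>F k in sequentially. (\<integral>x. min (Y s x) (R k) \<partial>M) \<le> \<epsilon> * R k / \<phi> (R k)"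
    proof eventually_elim
      case (elim k)
      then show ?case using \<phi>_pos[of k] R_pos[of k] by (simp add: field_simps)
    qed
  qed
  then have "\<exists>\<^sub>F k in sequentially.
      T \<le> R k \<and> (\<forall>s\<in>S. (\<integral>x. min (Y s x) (R k) \<partial>M) \<le> \<epsilon> * R k / \<phi> (R k))"
    using T_le by (intro eventually_frequently) simp_all
  then show ?thesis
    using filterlim_iff[THEN iffD1, OF R_top] unfolding frequently_def by blast
qed

lemma sum_measure_le_multiplicity:
  assumes F: "finite F" and P: "\<And>i. i \<in> F \<Longrightarrow> P i \<in> sets M"
    and multiplicity: "\<And>x. x \<in> space M \<Longrightarrow> card {i \<in> F. x \<in> P i} \<le> n"
  shows "(\<Sum>i\<in>F. measure M (P i)) \<le> real n * measure M (space M)"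
proof -
  have "(\<Sum>i\<in>F. measure M (P i)) = (\<Sum>i\<in>F. \<integral>x. indicator (P i) x \<partial>M)"
    using P by (intro sum.cong) (auto simp: Int_absorb2 sets.sets_into_space)
  also have "\<dots> = (\<integral>x. (\<Sum>i\<in>F. indicator (P i) x) \<partial>M)"
    using P by (intro Bochner_Integration.integral_sum[symmetric]) (simp add: less_top[symmetric])
  also have "\<dots> \<le> (\<integral>x. real n \<partial>M)"
  proof (rule integral_mono)
    show "integrable M (\<lambda>x. \<Sum>i\<in>F. indicator (P i) x :: real)"
      using P by (intro Bochner_Integration.integrable_sum) (simp add: less_top[symmetric])
    show "(\<Sum>i\<in>F. indicator (P i) x) \<le> real n" if "x \<in> space M" for x
      using multiplicity[OF that] F by (simp add: indicator_def sum.If_cases Int_def)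
  qed simp
  finally show ?thesis by (simp add: mult.commute)
qed

end

section \<open>Measure-preserving actions and fundamental domains\<close>

locale countable_mp_action = group G for G (structure) +
  fixes M :: "'w measure" and a
  assumes action: "free_mp_action G M a"
    and countable_group: "countable (carrier G)"
begin

lemma act_one: "x \<in> space M \<Longrightarrow> a \<one> x = x"
  and act_mult: "\<lbrakk>g \<in> carrier G; h \<in> carrier G; x \<in> space M\<rbrakk> \<Longrightarrow> a (g \<otimes> h) x = a g (a h x)"
  and act_measurable [measurable]: "g \<in> carrier G \<Longrightarrow> a g \<in> measurable M M"
  and act_distr: "g \<in> carrier G \<Longrightarrow> distr M M (a g) = M"
  using action unfolding free_mp_action_def by auto

lemma act_closed [simp]: "\<lbrakk>g \<in> carrier G; x \<in> space M\<rbrakk> \<Longrightarrow> a g x \<in> space M"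
  using act_measurable measurable_space by metis

lemma act_inv_act [simp]: "\<lbrakk>g \<in> carrier G; x \<in> space M\<rbrakk> \<Longrightarrow> a (inv g) (a g x) = x"
  using act_mult[of "inv g" g x] act_one by simp

lemma Int_act_vimage_sets:
  assumes "g \<in> carrier G" and B: "B \<in> sets M" and "A \<in> sets M"
  shows "B \<inter> a g -` A \<in> sets M"
proof -
  have "B \<inter> a g -` A = B \<inter> (a g -` A \<inter> space M)" using sets.sets_into_space[OF B] by auto
  then show ?thesis using assms by (simp add: measurable_sets)
qed

lemma emeasure_act_vimage:
  "\<lbrakk>g \<in> carrier G; A \<in> sets M\<rbrakk> \<Longrightarrow> emeasure M (a g -` A \<inter> space M) = emeasure M A"
  using emeasure_distr[OF act_measurable] act_distr by metis

definition wandering :: "'w set \<Rightarrow> bool" where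
  "wandering A \<longleftrightarrow> (\<forall>g\<in>carrier G. \<forall>x\<in>A. a g x \<in> A \<longrightarrow> g = \<one>)"

lemma wandering_eq:
  assumes A: "wandering A" and g: "g \<in> carrier G" and h: "h \<in> carrier G" and x: "x \<in> space M"
    and "a g x \<in> A" "a h x \<in> A"
  shows "g = h"
proof -
  have "a (g \<otimes> inv h) (a h x) = a g x" using g h x by (simp add: act_mult)
  moreover have "a (g \<otimes> inv h) (a h x) \<in> A \<Longrightarrow> g \<otimes> inv h = \<one>"
    using A g h \<open>a h x \<in> A\<close> unfolding wandering_def by blast
  ultimately have "g \<otimes> inv h = \<one>" using \<open>a g x \<in> A\<close> by simp
  then show ?thesis using g h inv_equality[of g "inv h"] by simp
qed

definition return_elt :: "'w set \<Rightarrow> 'w \<Rightarrow> 'a" where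
  "return_elt D x = (THE g. g \<in> carrier G \<and> a g x \<in> D)"

definition return_map :: "'w set \<Rightarrow> 'w \<Rightarrow> 'w" where
  "return_map D x = a (return_elt D x) x"

context
  fixes D
  assumes D: "fund_domain G M a D"
begin

lemma fund_domain_sets [measurable]: "D \<in> sets M"
  using D by (simp add: fund_domain_def)

lemma fund_domain_finite: "emeasure M D < Orderings.top"
  using D unfolding fund_domain_def by blast

lemma fund_domain_subset_space: "D \<subseteq> space M"
  using fund_domain_sets by (rule sets.sets_into_space)

lemma ex1_return: "x \<in> space M \<Longrightarrow> \<exists>!g. g \<in> carrier G \<and> a g x \<in> D"
  using D by (simp add: fund_domain_def)

lemma return_elt_closed [simp]: "x \<in> space M \<Longrightarrow> return_elt D x \<in> carrier G"
  and return_map_in_fund_domain: "x \<in> space M \<Longrightarrow> return_map D x \<in> D"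
  using theI'[OF ex1_return] unfolding return_elt_def return_map_def by blast+

lemma return_elt_eq_iff:
  "\<lbrakk>x \<in> space M; g \<in> carrier G\<rbrakk> \<Longrightarrow> return_elt D x = g \<longleftrightarrow> a g x \<in> D"
  using ex1_return return_elt_closed return_map_in_fund_domain unfolding return_map_def by metis

lemma return_elt_on_fund_domain: "x \<in> D \<Longrightarrow> return_elt D x = \<one>"
  using fund_domain_subset_space by (auto simp: return_elt_eq_iff act_one subset_iff)

lemma return_map_on_fund_domain: "x \<in> D \<Longrightarrow> return_map D x = x"
  using fund_domain_subset_space by (auto simp: return_map_def return_elt_on_fund_domain act_one)

lemma return_elt_act:
  assumes "g \<in> carrier G" "x \<in> space M"
  shows "return_elt D (a g x) = return_elt D x \<otimes> inv g"
proof -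
  have "a (return_elt D x \<otimes> inv g) (a g x) = return_map D x"
    using assms by (simp add: act_mult return_map_def)
  then show ?thesis using assms by (simp add: return_elt_eq_iff return_map_in_fund_domain)
qed

lemma return_map_act:
  "\<lbrakk>g \<in> carrier G; x \<in> space M\<rbrakk> \<Longrightarrow> return_map D (a g x) = return_map D x"
  by (simp add: return_map_def return_elt_act act_mult)

lemma return_elt_measurable: "return_elt D \<in> measurable M (count_space (carrier G))"
proof -
  have "return_elt D -` {g} \<inter> space M \<in> sets M" if g: "g \<in> carrier G" for g
  proof -
    have "return_elt D -` {g} \<inter> space M = a g -` D \<inter> space M"
      using return_elt_eq_iff[OF _ g] by auto
    then show ?thesis using g by (simp add: measurable_sets)
  qed
  then show ?thesis by (simp add: measurable_count_space_eq_countable[OF countable_group])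
qed

lemma return_map_measurable: "return_map D \<in> measurable M M"
  unfolding return_map_def
  using act_measurable return_elt_measurable countable_group
  by (rule measurable_compose_countable')

lemma emeasure_eq_nn_integral_translates:
  assumes B: "B \<in> sets M"
  shows "emeasure M B = (\<integral>\<^sup>+g. emeasure M (B \<inter> a g -` D) \<partial>count_space (carrier G))"
proof -
  note B_space = sets.sets_into_space[OF B]
  have "(\<Union>g\<in>carrier G. B \<inter> a g -` D) = B"
  proof (intro equalityI subsetI)
    fix x assume x: "x \<in> B"
    then obtain g where "g \<in> carrier G" "a g x \<in> D" using B_space ex1_return[of x] by auto
    with x show "x \<in> (\<Union>g\<in>carrier G. B \<inter> a g -` D)" by blast
  qed blast
  moreover have "emeasure M (\<Union>g\<in>carrier G. B \<inter> a g -` D)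
      = (\<integral>\<^sup>+g. emeasure M (B \<inter> a g -` D) \<partial>count_space (carrier G))"
  proof (rule emeasure_UN_countable[OF _ countable_group])
    show "B \<inter> a g -` D \<in> sets M" if "g \<in> carrier G" for g
      using that B fund_domain_sets by (rule Int_act_vimage_sets)
    show "disjoint_family_on (\<lambda>g. B \<inter> a g -` D) (carrier G)"
      unfolding disjoint_family_on_def
    proof (intro ballI impI, rule ccontr)
      fix g h assume "g \<in> carrier G" "h \<in> carrier G" "g \<noteq> h"
      moreover assume "B \<inter> a g -` D \<inter> (B \<inter> a h -` D) \<noteq> {}"
      then obtain x where "x \<in> B" "a g x \<in> D" "a h x \<in> D" by blast
      ultimately show False using B_space ex1_return[of x] by blast
    qed
  qed
  ultimately show ?thesis by simp
qed

lemma wandering_fund_domain_translate: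
  assumes g: "g \<in> carrier G"
  shows "wandering (a g -` D \<inter> space M)"
  unfolding wandering_def
proof (intro ballI impI)
  fix h x assume h: "h \<in> carrier G" and "x \<in> a g -` D \<inter> space M" "a h x \<in> a g -` D \<inter> space M"
  then have "a (g \<otimes> h) x \<in> D" "a g x \<in> D" "x \<in> space M" using g by (auto simp: act_mult)
  then have "g \<otimes> h = g" using g h ex1_return[of x] by blast
  then show "h = \<one>" using g h by (simp add: r_cancel_one')
qed

lemma ex_wandering_subset:
  assumes B: "B \<in> sets M" and pos: "0 < emeasure M B"
  obtains A where "A \<subseteq> B" "A \<in> sets M" "wandering A" "0 < emeasure M A"
proof -
  have "\<exists>g\<in>carrier G. emeasure M (B \<inter> a g -` D) \<noteq> 0"
  proof (rule ccontr)
    assume "\<not> ?thesis"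
    then have "emeasure M B = (\<integral>\<^sup>+g. 0 \<partial>count_space (carrier G))"
      unfolding emeasure_eq_nn_integral_translates[OF B] by (intro nn_integral_cong) auto
    then show False using pos by simp
  qed
  then obtain g where g: "g \<in> carrier G" and g_pos: "emeasure M (B \<inter> a g -` D) \<noteq> 0" by blast
  show ?thesis
  proof
    show "B \<inter> a g -` D \<in> sets M"
      using g B fund_domain_sets by (rule Int_act_vimage_sets)
    show "wandering (B \<inter> a g -` D)"
      using wandering_fund_domain_translate[OF g] sets.sets_into_space[OF B]
      unfolding wandering_def by blast
    show "0 < emeasure M (B \<inter> a g -` D)" using g_pos by (simp add: zero_less_iff_neq_zero)
  qed simp
qed

end

lemma emeasure_invariant_Int_fund_domain:
  assumes D: "fund_domain G M a D" and E: "fund_domain G M a E" and B: "B \<in> sets M"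
    and invariant: "\<And>g x. \<lbrakk>g \<in> carrier G; x \<in> space M\<rbrakk> \<Longrightarrow> a g x \<in> B \<longleftrightarrow> x \<in> B"
  shows "emeasure M (D \<inter> B) = emeasure M (E \<inter> B)"
proof -
  let ?C = "count_space (carrier G)"
  note [measurable] = B fund_domain_sets[OF D] fund_domain_sets[OF E]
  have translate: "emeasure M (D \<inter> B \<inter> a g -` E) = emeasure M (E \<inter> B \<inter> a (inv g) -` D)"
    if g: "g \<in> carrier G" for g
  proof -
    have "D \<inter> B \<inter> a g -` E = a g -` (E \<inter> B \<inter> a (inv g) -` D) \<inter> space M"
      using g fund_domain_subset_space[OF D] by (auto simp: invariant)
    moreover have "E \<inter> B \<inter> a (inv g) -` D \<in> sets M"
      using g by (intro Int_act_vimage_sets) simp_all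
    ultimately show ?thesis using emeasure_act_vimage[OF g] by metis
  qed
  have "bij_betw (m_inv G) (carrier G) (carrier G)"
    by (rule bij_betw_byWitness[where f' = "m_inv G"]) auto
  then have reindex: "(\<integral>\<^sup>+g. emeasure M (E \<inter> B \<inter> a (inv g) -` D) \<partial>?C)
      = (\<integral>\<^sup>+g. emeasure M (E \<inter> B \<inter> a g -` D) \<partial>?C)"
    by (rule nn_integral_bij_count_space)
  have "emeasure M (D \<inter> B) = (\<integral>\<^sup>+g. emeasure M (D \<inter> B \<inter> a g -` E) \<partial>?C)"
    by (rule emeasure_eq_nn_integral_translates[OF E]) simp
  also have "\<dots> = (\<integral>\<^sup>+g. emeasure M (E \<inter> B \<inter> a (inv g) -` D) \<partial>?C)"
    using translate by (intro nn_integral_cong) simp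
  also have "\<dots> = emeasure M (E \<inter> B)"
    unfolding reindex by (rule emeasure_eq_nn_integral_translates[OF D, symmetric]) simp
  finally show ?thesis .
qed

end

section \<open>The induced action on a fundamental domain\<close>

locale induced_action =
  G: countable_mp_action G M aG + L: countable_mp_action L M aL
  for G :: "('g, 'b) monoid_scheme" and L :: "('l, 'c) monoid_scheme"
    and M :: "'w measure" and aG aL +
  fixes D
  assumes commute: "\<lbrakk>g \<in> carrier G; l \<in> carrier L; x \<in> space M\<rbrakk> \<Longrightarrow> aG g (aL l x) = aL l (aG g x)"
    and fund_domain_D: "fund_domain L M aL D"
begin

abbreviation cocycle :: "'g \<Rightarrow> 'w \<Rightarrow> 'l" where
  "cocycle \<equiv> me_cocycle L aG aL D"

definition induced :: "'g \<Rightarrow> 'w \<Rightarrow> 'w" where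
  "induced g x = L.return_map D (aG g x)"

abbreviation \<nu> :: "'w measure" where
  "\<nu> \<equiv> restrict_space M D"

lemmas D_sets [measurable] = L.fund_domain_sets[OF fund_domain_D]

lemma in_D_imp_in_space: "x \<in> D \<Longrightarrow> x \<in> space M"
  using L.fund_domain_subset_space[OF fund_domain_D] by blast

lemma space_\<nu>: "space \<nu> = D"
  by simp

lemma sets_\<nu>_iff: "A \<in> sets \<nu> \<longleftrightarrow> A \<subseteq> D \<and> A \<in> sets M"
  by (intro sets_restrict_space_iff) simp

lemma emeasure_\<nu>: "A \<subseteq> D \<Longrightarrow> emeasure \<nu> A = emeasure M A"
  by (intro emeasure_restrict_space) simp_all

sublocale \<nu>: finite_measure \<nu>
proof
  show "emeasure \<nu> (space \<nu>) \<noteq> \<infinity>"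
    using L.fund_domain_finite[OF fund_domain_D] by (simp add: emeasure_\<nu> less_top)
qed

lemma cocycle_eq_return_elt: "cocycle g x = L.return_elt D (aG g x)"
  by (simp add: me_cocycle_def L.return_elt_def)

lemma cocycle_closed: "\<lbrakk>g \<in> carrier G; x \<in> space M\<rbrakk> \<Longrightarrow> cocycle g x \<in> carrier L"
  by (simp add: cocycle_eq_return_elt L.return_elt_closed[OF fund_domain_D])

lemma induced_eq: "induced g x = aL (cocycle g x) (aG g x)"
  by (simp add: induced_def L.return_map_def cocycle_eq_return_elt)

lemma induced_in_D: "\<lbrakk>g \<in> carrier G; x \<in> space M\<rbrakk> \<Longrightarrow> induced g x \<in> D"
  by (simp add: induced_def L.return_map_in_fund_domain[OF fund_domain_D])

lemma cocycle_mult: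
  assumes g: "g \<in> carrier G" and h: "h \<in> carrier G" and x: "x \<in> space M"
  shows "cocycle (g \<otimes>\<^bsub>G\<^esub> h) x = cocycle g (induced h x) \<otimes>\<^bsub>L\<^esub> cocycle h x"
proof -
  have l: "cocycle h x \<in> carrier L" using h x by (rule cocycle_closed)
  have "aG g (induced h x) = aL (cocycle h x) (aG (g \<otimes>\<^bsub>G\<^esub> h) x)"
    using g h x l by (simp add: induced_eq commute G.act_mult)
  then have "cocycle g (induced h x) = cocycle (g \<otimes>\<^bsub>G\<^esub> h) x \<otimes>\<^bsub>L\<^esub> inv\<^bsub>L\<^esub> cocycle h x"
    using g h x l by (simp add: L.return_elt_act[OF fund_domain_D] cocycle_eq_return_elt)
  then show ?thesis
    using l cocycle_closed[of "g \<otimes>\<^bsub>G\<^esub> h" x] g h x by (simp add: L.m_assoc)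
qed

lemma cocycle_one: "x \<in> D \<Longrightarrow> cocycle \<one>\<^bsub>G\<^esub> x = \<one>\<^bsub>L\<^esub>"
  by (simp add: cocycle_eq_return_elt G.act_one in_D_imp_in_space
      L.return_elt_on_fund_domain[OF fund_domain_D])

lemma inj_on_cocycle_wandering:
  assumes A: "G.wandering A" and x: "x \<in> space M"
  shows "inj_on (\<lambda>g. cocycle g x) {g \<in> carrier G. induced g x \<in> A}"
proof (rule inj_onI)
  fix g h assume "g \<in> {g \<in> carrier G. induced g x \<in> A}" "h \<in> {g \<in> carrier G. induced g x \<in> A}"
    and eq: "cocycle g x = cocycle h x"
  then have g: "g \<in> carrier G" "induced g x \<in> A" and h: "h \<in> carrier G" "induced h x \<in> A"
    by auto
  let ?y = "aL (cocycle g x) x"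
  have l: "cocycle g x \<in> carrier L" using g(1) x by (rule cocycle_closed)
  have "?y \<in> space M" using l x by simp
  moreover have "aG g ?y \<in> A" using g l x by (simp add: induced_eq commute)
  moreover have "aG h ?y \<in> A" using h l x by (simp add: induced_eq commute eq)
  ultimately show "g = h" by (rule G.wandering_eq[OF A g(1) h(1)])
qed

lemma cocycle_measurable:
  assumes "g \<in> carrier G"
  shows "cocycle g \<in> measurable \<nu> (count_space (carrier L))"
  unfolding cocycle_eq_return_elt[abs_def]
  using G.act_measurable[OF assms] L.return_elt_measurable[OF fund_domain_D]
  by (rule measurable_restrict_space1[OF measurable_compose])

lemma cocycle_function_measurable:
  assumes "g \<in> carrier G" "\<And>l. l \<in> carrier L \<Longrightarrow> h l \<in> space N"
  shows "(\<lambda>x. h (cocycle g x)) \<in> measurable \<nu> N"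
  using cocycle_measurable[OF assms(1)] by (rule measurable_compose) (simp add: assms(2))

lemma cocycle_vimage_sets:
  assumes "g \<in> carrier G"
  shows "{x \<in> D. cocycle g x \<in> B} \<in> sets \<nu>"
proof -
  have "{x \<in> D. cocycle g x \<in> B} = cocycle g -` (B \<inter> carrier L) \<inter> space \<nu>"
    using assms by (auto simp: cocycle_closed in_D_imp_in_space)
  then show ?thesis
    using measurable_sets[OF cocycle_measurable[OF assms], of "B \<inter> carrier L"] by simp
qed

lemma induced_measurable [measurable]:
  assumes "g \<in> carrier G"
  shows "induced g \<in> measurable \<nu> \<nu>"
proof (rule measurable_restrict_space2)
  show "induced g \<in> space \<nu> \<rightarrow> D" using assms by (simp add: induced_in_D in_D_imp_in_space)
  show "induced g \<in> measurable \<nu> M"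
    unfolding induced_def[abs_def]
    using G.act_measurable[OF assms] L.return_map_measurable[OF fund_domain_D]
    by (rule measurable_restrict_space1[OF measurable_compose])
qed

lemma fund_domain_act_vimage:
  assumes g: "g \<in> carrier G"
  shows "fund_domain L M aL (aG g -` D \<inter> space M)"
  unfolding fund_domain_def
proof (intro conjI ballI)
  show "aG g -` D \<inter> space M \<in> sets M" using g by (simp add: measurable_sets)
  show "emeasure M (aG g -` D \<inter> space M) < Orderings.top"
    unfolding G.emeasure_act_vimage[OF g D_sets] by (rule L.fund_domain_finite[OF fund_domain_D])
  fix x assume x: "x \<in> space M"
  have eq: "l \<in> carrier L \<and> aL l x \<in> aG g -` D \<inter> space M
      \<longleftrightarrow> l \<in> carrier L \<and> aL l (aG g x) \<in> D" for l
    using x g by (auto simp: commute)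
  show "\<exists>!l. l \<in> carrier L \<and> aL l x \<in> aG g -` D \<inter> space M"
    unfolding eq using g x by (intro L.ex1_return[OF fund_domain_D]) simp
qed

lemma distr_induced:
  assumes g: "g \<in> carrier G"
  shows "distr \<nu> \<nu> (induced g) = \<nu>"
proof (rule measure_eqI)
  fix A assume "A \<in> sets (distr \<nu> \<nu> (induced g))"
  then have A: "A \<subseteq> D" "A \<in> sets M" by (simp_all add: sets_\<nu>_iff)
  define B where "B = L.return_map D -` A \<inter> space M"
  have B: "B \<in> sets M"
    unfolding B_def using L.return_map_measurable[OF fund_domain_D] A(2) by (rule measurable_sets)
  have ig: "inv\<^bsub>G\<^esub> g \<in> carrier G" using g by simp
  let ?gD = "aG (inv\<^bsub>G\<^esub> g) -` D \<inter> space M"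
  have gD: "fund_domain L M aL ?gD" by (rule fund_domain_act_vimage[OF ig])
  have "induced g -` A \<inter> D = aG g -` (?gD \<inter> B) \<inter> space M"
    using g in_D_imp_in_space by (auto simp: B_def induced_def)
  then have "emeasure M (induced g -` A \<inter> D) = emeasure M (?gD \<inter> B)"
    using G.emeasure_act_vimage[OF g sets.Int[OF L.fund_domain_sets[OF gD] B]] by (simp only:)
  also have "\<dots> = emeasure M (D \<inter> B)"
    by (rule L.emeasure_invariant_Int_fund_domain[OF gD fund_domain_D B])
      (simp add: B_def L.return_map_act[OF fund_domain_D])
  also have "D \<inter> B = A"
    using A in_D_imp_in_space by (auto simp: B_def L.return_map_on_fund_domain[OF fund_domain_D])
  finally show "emeasure (distr \<nu> \<nu> (induced g)) A = emeasure \<nu> A"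
    using g A by (simp add: emeasure_distr emeasure_\<nu> sets_\<nu>_iff)
qed simp

lemma measure_induced_vimage:
  assumes "g \<in> carrier G" "A \<in> sets \<nu>"
  shows "measure \<nu> (induced g -` A \<inter> D) = measure \<nu> A"
  using measure_distr[OF induced_measurable[OF assms(1)] assms(2)]
  by (simp only: distr_induced[OF assms(1)] space_\<nu>)

lemma integral_induced:
  fixes F :: "'w \<Rightarrow> real"
  assumes "g \<in> carrier G" "F \<in> borel_measurable \<nu>"
  shows "(\<integral>x. F (induced g x) \<partial>\<nu>) = (\<integral>x. F x \<partial>\<nu>)"
  using integral_distr[OF induced_measurable[OF assms(1)] assms(2)]
  by (simp only: distr_induced[OF assms(1)])

lemma integrable_cocycle:
  fixes \<theta> :: "'l \<Rightarrow> real"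
  assumes "g \<in> carrier G" "\<And>l. l \<in> carrier L \<Longrightarrow> \<bar>\<theta> l\<bar> \<le> R"
  shows "integrable \<nu> (\<lambda>x. \<theta> (cocycle g x))"
proof (rule \<nu>.integrable_const_bound)
  show "AE x in \<nu>. norm (\<theta> (cocycle g x)) \<le> R"
    using assms by (intro AE_I2) (simp add: cocycle_closed in_D_imp_in_space)
  show "(\<lambda>x. \<theta> (cocycle g x)) \<in> borel_measurable \<nu>"
    using assms(1) by (intro cocycle_function_measurable) simp_all
qed

lemma integral_subadditive_cocycle_le:
  fixes \<theta> :: "'l \<Rightarrow> real"
  assumes S: "S \<subseteq> carrier G"
    and subadditive: "\<And>k l. \<lbrakk>k \<in> carrier L; l \<in> carrier L\<rbrakk> \<Longrightarrow> \<theta> (k \<otimes>\<^bsub>L\<^esub> l) \<le> \<theta> k + \<theta> l"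
    and one: "\<theta> \<one>\<^bsub>L\<^esub> = 0" and bounded: "\<And>l. l \<in> carrier L \<Longrightarrow> \<bar>\<theta> l\<bar> \<le> R"
    and letters_le: "\<And>s. s \<in> G.letters S \<Longrightarrow> (\<integral>x. \<theta> (cocycle s x) \<partial>\<nu>) \<le> B"
    and g: "g \<in> word_ball G S n"
  shows "(\<integral>x. \<theta> (cocycle g x) \<partial>\<nu>) \<le> real n * B"
  using g
proof (induction n arbitrary: g)
  case 0
  have "(\<integral>x. \<theta> (cocycle g x) \<partial>\<nu>) = (\<integral>x. 0 \<partial>\<nu>)"
    using 0 by (intro Bochner_Integration.integral_cong refl) (simp add: cocycle_one one)
  then show ?case by simp
next
  case (Suc n)
  then obtain h s where g_eq: "g = h \<otimes>\<^bsub>G\<^esub> s" and h_ball: "h \<in> word_ball G S n"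
    and s_letter: "s \<in> G.letters S" by auto
  have h: "h \<in> carrier G" using h_ball G.word_ball_subset_carrier[OF S] by blast
  have s: "s \<in> carrier G" using s_letter G.letters_subset_carrier[OF S] by blast
  have integrable: "integrable \<nu> (\<lambda>x. \<theta> (cocycle k x))" if "k \<in> carrier G" for k
    using that bounded by (rule integrable_cocycle)
  have integrable_induced: "integrable \<nu> (\<lambda>x. \<theta> (cocycle h (induced s x)))"
    using integrable[OF h] by (intro integrable_distr[OF induced_measurable[OF s]])
      (simp add: distr_induced s)
  have "(\<integral>x. \<theta> (cocycle g x) \<partial>\<nu>) \<le> (\<integral>x. \<theta> (cocycle h (induced s x)) + \<theta> (cocycle s x) \<partial>\<nu>)"
  proof (rule integral_mono)
    show "integrable \<nu> (\<lambda>x. \<theta> (cocycle g x))"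
      using h s by (intro integrable) (simp add: g_eq)
    show "integrable \<nu> (\<lambda>x. \<theta> (cocycle h (induced s x)) + \<theta> (cocycle s x))"
      using integrable_induced integrable[OF s] by (rule Bochner_Integration.integrable_add)
  next
    fix x assume "x \<in> space \<nu>"
    then have "x \<in> space M" using in_D_imp_in_space by simp
    then show "\<theta> (cocycle g x) \<le> \<theta> (cocycle h (induced s x)) + \<theta> (cocycle s x)"
      using h s
      by (simp add: g_eq cocycle_mult subadditive cocycle_closed induced_in_D in_D_imp_in_space)
  qed
  also have "\<dots> = (\<integral>x. \<theta> (cocycle h (induced s x)) \<partial>\<nu>) + (\<integral>x. \<theta> (cocycle s x) \<partial>\<nu>)"
    using integrable_induced integrable[OF s] by (rule Bochner_Integration.integral_add)
  also have "\<dots> = (\<integral>x. \<theta> (cocycle h x) \<partial>\<nu>) + (\<integral>x. \<theta> (cocycle s x) \<partial>\<nu>)"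
    using integral_induced[OF s borel_measurable_integrable[OF integrable[OF h]]] by (simp only:)
  also have "\<dots> \<le> real n * B + B"
    using Suc.IH[OF h_ball] letters_le[OF s_letter] by (rule add_mono)
  finally show ?case by (simp add: algebra_simps)
qed

lemma ex_wandering_subset:
  assumes E: "fund_domain G M aG E" and pos: "0 < emeasure M D"
  obtains A where "A \<in> sets \<nu>" "G.wandering A" "0 < measure \<nu> A"
proof -
  obtain A where "A \<subseteq> D" "A \<in> sets M" "G.wandering A" "0 < emeasure M A"
    by (rule G.ex_wandering_subset[OF E D_sets pos])
  then show ?thesis
    using that emeasure_\<nu> \<nu>.emeasure_eq_measure[of A] by (auto simp: sets_\<nu>_iff)
qed

lemma card_mult_measure_wandering_le:
  assumes A: "A \<in> sets \<nu>" "G.wandering A"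
    and F: "finite F" "F \<subseteq> carrier G" and B: "finite B"
    and escape: "\<And>g. g \<in> F \<Longrightarrow> measure \<nu> {x \<in> D. cocycle g x \<notin> B} \<le> measure \<nu> A / 2"
  shows "real (card F) * measure \<nu> A \<le> 2 * real (card B) * measure \<nu> D"
proof -
  define P where "P g = {x \<in> D. cocycle g x \<in> B} \<inter> (induced g -` A \<inter> D)" for g
  have induced_sets: "induced g -` A \<inter> D \<in> sets \<nu>" if "g \<in> carrier G" for g
    using measurable_sets[OF induced_measurable[OF that] A(1)] unfolding space_\<nu> .
  have P_sets: "P g \<in> sets \<nu>" if "g \<in> F" for g
    unfolding P_def using subsetD[OF F(2) that]
    by (intro sets.Int cocycle_vimage_sets induced_sets)
  have P_large: "measure \<nu> A / 2 \<le> measure \<nu> (P g)" if "g \<in> F" for g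
  proof -
    have g: "g \<in> carrier G" using that F(2) by blast
    have escape_sets: "{x \<in> D. cocycle g x \<notin> B} \<in> sets \<nu>"
      using cocycle_vimage_sets[OF g, of "- B"] by simp
    have "measure \<nu> A = measure \<nu> (induced g -` A \<inter> D)"
      using g A(1) by (rule measure_induced_vimage[symmetric])
    also have "\<dots> \<le> measure \<nu> (P g \<union> {x \<in> D. cocycle g x \<notin> B})"
      using P_sets[OF that] escape_sets by (intro \<nu>.finite_measure_mono) (auto simp: P_def)
    also have "\<dots> \<le> measure \<nu> (P g) + measure \<nu> {x \<in> D. cocycle g x \<notin> B}"
      using P_sets[OF that] escape_sets by (rule measure_Un_le)
    finally show ?thesis using escape[OF that] by simp
  qed
  have "real (card F) * (measure \<nu> A / 2) \<le> (\<Sum>g\<in>F. measure \<nu> (P g))"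
    using P_large by (rule sum_bounded_below)
  also have "\<dots> \<le> real (card B) * measure \<nu> (space \<nu>)"
  proof (rule \<nu>.sum_measure_le_multiplicity[OF F(1) P_sets])
    fix x assume "x \<in> space \<nu>"
    then have x: "x \<in> space M" using in_D_imp_in_space by simp
    have "inj_on (\<lambda>g. cocycle g x) {g \<in> F. x \<in> P g}"
      by (rule inj_on_subset[OF inj_on_cocycle_wandering[OF A(2) x]])
        (use F(2) in \<open>auto simp: P_def\<close>)
    then show "card {g \<in> F. x \<in> P g} \<le> card B"
      using B by (intro card_inj_on_le) (auto simp: P_def)
  qed
  finally show ?thesis by (simp add: mult_ac)
qed

end

section \<open>Comparison of volume growths\<close>

locale fin_gen_induced_action =
  induced_action G L M aG aL D + G: fin_gen_group G SG + L: fin_gen_group L SL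
  for G :: "('g, 'b) monoid_scheme" and L :: "('l, 'c) monoid_scheme"
    and M :: "'w measure" and aG aL D SG SL
begin

abbreviation cocycle_length :: "'g \<Rightarrow> 'w \<Rightarrow> real" where
  "cocycle_length g x \<equiv> real (word_length L SL (cocycle g x))"

lemma ex_common_integrability_scale:
  assumes int: "phi_integrable_cocycle \<phi> G L SL M aG aL D"
    and mono: "mono_on {T..} \<phi>" and \<phi>_T: "0 \<le> \<phi> T" and S: "finite S" "S \<subseteq> carrier G"
  obtains c where "0 < c" "\<And>s. s \<in> S \<Longrightarrow> integrable \<nu>
    (\<lambda>x. indicator {T..} (cocycle_length s x / c) * \<phi> (cocycle_length s x / c))"
proof -
  have "\<forall>s\<in>S. \<exists>d>0. (\<integral>\<^sup>+x. ennreal (\<phi> (cocycle_length s x / d)) \<partial>\<nu>) < \<infinity>"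
    using int S(2) unfolding phi_integrable_cocycle_def by (auto simp: nn_integral_restrict_space)
  then obtain d where d_pos: "\<And>s. s \<in> S \<Longrightarrow> 0 < d s"
    and d_int: "\<And>s. s \<in> S \<Longrightarrow> (\<integral>\<^sup>+x. ennreal (\<phi> (cocycle_length s x / d s)) \<partial>\<nu>) < \<infinity>"
    by metis
  define c where "c = Max (insert 1 (d ` S))"
  have d_le: "d s \<le> c" if "s \<in> S" for s unfolding c_def using that S(1) by simp
  have "1 \<le> c" unfolding c_def using S(1) by simp
  then have c: "0 < c" by simp
  moreover have "integrable \<nu>
      (\<lambda>x. indicator {T..} (cocycle_length s x / c) * \<phi> (cocycle_length s x / c))"
    if s: "s \<in> S" for s
  proof (rule integrableI_nonneg)
    let ?f = "\<lambda>x. indicator {T..} (cocycle_length s x / c) * \<phi> (cocycle_length s x / c)"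
    show "?f \<in> borel_measurable \<nu>"
      using s S(2) by (intro cocycle_function_measurable[where h = "\<lambda>l.
          indicator {T..} (real (word_length L SL l) / c) * \<phi> (real (word_length L SL l) / c)"])
        auto
    have nonneg: "0 \<le> \<phi> y" if "T \<le> y" for y
      using mono_onD[OF mono, of T y] that \<phi>_T by simp
    then show "AE x in \<nu>. 0 \<le> ?f x" by (intro AE_I2) (simp split: split_indicator)
    have "ennreal (?f x) \<le> ennreal (\<phi> (cocycle_length s x / d s))" for x
    proof (cases "T \<le> cocycle_length s x / c")
      case True
      moreover have "cocycle_length s x / c \<le> cocycle_length s x / d s"
        using d_pos[OF s] d_le[OF s] by (intro divide_left_mono) auto
      ultimately show ?thesis using mono_onD[OF mono] by (simp add: ennreal_leI)
    qed simp
    then have "(\<integral>\<^sup>+x. ennreal (?f x) \<partial>\<nu>) \<le> (\<integral>\<^sup>+x. ennreal (\<phi> (cocycle_length s x / d s)) \<partial>\<nu>)"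
      by (rule nn_integral_mono)
    then show "(\<integral>\<^sup>+x. ennreal (?f x) \<partial>\<nu>) < \<infinity>" using d_int[OF s] by (rule le_less_trans)
  qed
  ultimately show ?thesis by (rule that)
qed

lemma measure_long_cocycle_le:
  assumes c: "0 < c" and R: "0 < R"
    and letters_le: "\<And>s. s \<in> G.letters SG \<Longrightarrow> (\<integral>x. min (cocycle_length s x / c) R \<partial>\<nu>) \<le> B"
    and g: "g \<in> word_ball G SG n"
  shows "measure \<nu> {x \<in> D. cocycle g x \<notin> word_ball L SL (nat \<lfloor>c * R\<rfloor>)} \<le> real n * B / R"
proof -
  define \<theta> where "\<theta> l = min (real (word_length L SL l) / c) R" for l
  have bounded: "\<bar>\<theta> l\<bar> \<le> R" for l using c R by (simp add: \<theta>_def abs_of_nonneg)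
  have g_closed: "g \<in> carrier G"
    using g G.word_ball_subset_carrier[OF G.gens_subset_carrier] by blast
  have integrable: "integrable \<nu> (\<lambda>x. \<theta> (cocycle g x))"
    using g_closed bounded by (rule integrable_cocycle)
  have "{x \<in> D. cocycle g x \<notin> word_ball L SL (nat \<lfloor>c * R\<rfloor>)} \<subseteq> {x \<in> space \<nu>. R \<le> \<theta> (cocycle g x)}"
  proof safe
    fix x assume x: "x \<in> D" and "cocycle g x \<notin> word_ball L SL (nat \<lfloor>c * R\<rfloor>)"
    then have "nat \<lfloor>c * R\<rfloor> < word_length L SL (cocycle g x)"
      using L.in_word_ball_iff cocycle_closed[OF g_closed in_D_imp_in_space[OF x]]
      by (simp add: not_le)
    then have "c * R \<le> cocycle_length g x" by linarith
    then show "R \<le> \<theta> (cocycle g x)" using c by (simp add: \<theta>_def field_simps)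
  qed simp
  moreover have "{x \<in> space \<nu>. R \<le> \<theta> (cocycle g x)} \<in> sets \<nu>"
    using integrable by measurable
  ultimately have "measure \<nu> {x \<in> D. cocycle g x \<notin> word_ball L SL (nat \<lfloor>c * R\<rfloor>)}
      \<le> measure \<nu> {x \<in> space \<nu>. R \<le> \<theta> (cocycle g x)}"
    by (rule \<nu>.finite_measure_mono)
  also have "\<dots> \<le> (\<integral>x. \<theta> (cocycle g x) \<partial>\<nu>) / R"
    using c R by (intro integral_Markov_inequality_measure[OF integrable sets.top])
      (simp_all add: \<theta>_def)
  also have "\<dots> \<le> real n * B / R"
  proof (intro divide_right_mono
      integral_subadditive_cocycle_le[OF G.gens_subset_carrier _ _ bounded _ g])
    show "\<theta> (k \<otimes>\<^bsub>L\<^esub> l) \<le> \<theta> k + \<theta> l" if "k \<in> carrier L" "l \<in> carrier L" for k l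
    proof -
      have "real (word_length L SL (k \<otimes>\<^bsub>L\<^esub> l))
          \<le> real (word_length L SL k) + real (word_length L SL l)"
        using L.word_length_mult_le[OF that] by linarith
      then have "real (word_length L SL (k \<otimes>\<^bsub>L\<^esub> l)) / c
          \<le> real (word_length L SL k) / c + real (word_length L SL l) / c"
        using c by (simp add: field_simps)
      moreover have "0 \<le> real (word_length L SL k) / c" "0 \<le> real (word_length L SL l) / c"
        using c by simp_all
      ultimately show ?thesis unfolding \<theta>_def using R by linarith
    qed
  qed (use R letters_le in \<open>simp_all add: \<theta>_def\<close>)
  finally show ?thesis .
qed

lemma vol_growth_le_if_small_truncated_means:
  assumes A: "A \<in> sets \<nu>" "G.wandering A" and A_pos: "0 < measure \<nu> A"
    and c: "0 < c" and R: "0 < R" and B: "0 \<le> B" and x: "0 \<le> x"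
    and letters_le: "\<And>s. s \<in> G.letters SG \<Longrightarrow> (\<integral>x. min (cocycle_length s x / c) R \<partial>\<nu>) \<le> B"
    and escape: "(x + 1) * B / R \<le> measure \<nu> A / 2"
  shows "vol_growth G SG x \<le> 2 * measure \<nu> D / measure \<nu> A * vol_growth L SL (c * R)"
proof -
  let ?n = "nat \<lceil>x\<rceil>" and ?m = "nat \<lfloor>c * R\<rfloor>"
  have "vol_nat G SG ?n * measure \<nu> A \<le> 2 * vol_nat L SL ?m * measure \<nu> D"
    unfolding vol_nat_def
  proof (rule card_mult_measure_wandering_le[OF A])
    show "finite (word_ball G SG ?n)" "finite (word_ball L SL ?m)"
      by (rule G.finite_word_ball[OF G.finite_gens], rule L.finite_word_ball[OF L.finite_gens])
    show "word_ball G SG ?n \<subseteq> carrier G"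
      by (rule G.word_ball_subset_carrier[OF G.gens_subset_carrier])
    fix g assume "g \<in> word_ball G SG ?n"
    then have "measure \<nu> {x \<in> D. cocycle g x \<notin> word_ball L SL ?m} \<le> real ?n * B / R"
      using c R letters_le by (intro measure_long_cocycle_le)
    also have "\<dots> \<le> (x + 1) * B / R"
      using x B R by (intro divide_right_mono mult_right_mono) linarith+
    finally show "measure \<nu> {x \<in> D. cocycle g x \<notin> word_ball L SL ?m} \<le> measure \<nu> A / 2"
      using escape by linarith
  qed
  then have "vol_nat G SG ?n \<le> 2 * measure \<nu> D / measure \<nu> A * vol_nat L SL ?m"
    using A_pos by (simp add: field_simps)
  moreover have "vol_growth G SG x \<le> vol_nat G SG ?n"
    using x by (rule G.vol_growth_le_vol_nat_ceiling)
  moreover have "2 * measure \<nu> D / measure \<nu> A * vol_nat L SL ?m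
      \<le> 2 * measure \<nu> D / measure \<nu> A * vol_growth L SL (c * R)"
    using c R L.vol_nat_floor_le_vol_growth[of "c * R"] by (intro mult_left_mono) simp_all
  ultimately show ?thesis by linarith
qed

lemma ex_frequently_truncated_cocycle_means_le:
  assumes int: "phi_integrable_cocycle \<phi> G L SL M aG aL D"
    and mono: "mono_on {T..} \<phi>" and T: "0 < T" "0 < \<phi> T" and small: "\<phi> \<in> o[at_top](\<lambda>x. x)"
  obtains c where "0 < c" "\<And>\<epsilon>. 0 < \<epsilon> \<Longrightarrow> \<exists>\<^sub>F R in at_top. T \<le> R \<and>
    (\<forall>s\<in>G.letters SG. (\<integral>x. min (cocycle_length s x / c) R \<partial>\<nu>) \<le> \<epsilon> * R / \<phi> R)"
proof -
  let ?S = "G.letters SG"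
  have S: "finite ?S" "?S \<subseteq> carrier G"
    using G.finite_gens G.letters_subset_carrier[OF G.gens_subset_carrier] by simp_all
  obtain c where c: "0 < c" and integrable: "\<And>s. s \<in> ?S \<Longrightarrow> integrable \<nu>
      (\<lambda>x. indicator {T..} (cocycle_length s x / c) * \<phi> (cocycle_length s x / c))"
    using ex_common_integrability_scale[OF int mono less_imp_le[OF T(2)] S] by blast
  have measurable: "(\<lambda>x. cocycle_length s x / c) \<in> borel_measurable \<nu>" if "s \<in> ?S" for s
    using subsetD[OF S(2) that]
    by (rule cocycle_function_measurable[where h = "\<lambda>l. real (word_length L SL l) / c"]) simp
  have nonneg: "0 \<le> cocycle_length s x / c" for s x using c by simp
  have "\<exists>\<^sub>F R in at_top. T \<le> R \<and>
      (\<forall>s\<in>?S. (\<integral>x. min (cocycle_length s x / c) R \<partial>\<nu>) \<le> \<epsilon> * R / \<phi> R)" if "0 < \<epsilon>" for \<epsilon>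
    using S(1) measurable nonneg integrable mono T small that
    by (rule \<nu>.frequently_truncated_means_le)
  then show ?thesis using c that by blast
qed

lemma ex_frequently_vol_growth_le:
  assumes E: "fund_domain G M aG E" and D_pos: "0 < emeasure M D"
    and int: "phi_integrable_cocycle \<phi> G L SL M aG aL D"
    and mono: "mono_on {T..} \<phi>" and T: "0 < T" "0 < \<phi> T" and small: "\<phi> \<in> o[at_top](\<lambda>x. x)"
  obtains c K where "0 < c" "0 < K"
    "\<And>C. 0 < C \<Longrightarrow> \<exists>\<^sub>F R in at_top. vol_growth G SG (C * \<phi> R) \<le> K * vol_growth L SL (c * R)"
proof -
  obtain A where A: "A \<in> sets \<nu>" "G.wandering A" and A_pos: "0 < measure \<nu> A"
    by (rule ex_wandering_subset[OF E D_pos])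
  let ?K = "2 * measure \<nu> D / measure \<nu> A"
  have K: "0 < ?K"
    using A(1) A_pos \<nu>.finite_measure_mono[of A D] by (simp add: sets_\<nu>_iff)
  obtain c where c: "0 < c" and small_means: "\<And>\<epsilon>. 0 < \<epsilon> \<Longrightarrow> \<exists>\<^sub>F R in at_top. T \<le> R \<and>
      (\<forall>s\<in>G.letters SG. (\<integral>x. min (cocycle_length s x / c) R \<partial>\<nu>) \<le> \<epsilon> * R / \<phi> R)"
    using ex_frequently_truncated_cocycle_means_le[OF int mono T small] by blast
  have "\<exists>\<^sub>F R in at_top. vol_growth G SG (C * \<phi> R) \<le> ?K * vol_growth L SL (c * R)"
    if C: "0 < C" for C
  proof -
    define C' where "C' = C + 1 / \<phi> T"
    define \<epsilon> where "\<epsilon> = measure \<nu> A / (2 * C')"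
    have C': "0 < C'" using C T(2) by (simp add: C'_def add_pos_pos)
    then have \<epsilon>: "0 < \<epsilon>" using A_pos by (simp add: \<epsilon>_def)
    show ?thesis
    proof (rule frequently_elim1[OF small_means[OF \<epsilon>]], elim conjE)
      fix R
      assume R: "T \<le> R"
        and means: "\<forall>s\<in>G.letters SG. (\<integral>x. min (cocycle_length s x / c) R \<partial>\<nu>) \<le> \<epsilon> * R / \<phi> R"
      have R_pos: "0 < R" and \<phi>_le: "\<phi> T \<le> \<phi> R" using R T mono_onD[OF mono, of T R] by simp_all
      then have \<phi>_pos: "0 < \<phi> R" using T(2) by simp
      have "(C * \<phi> R + 1) * (\<epsilon> * R / \<phi> R) / R = (C + 1 / \<phi> R) * \<epsilon>"
        using R_pos \<phi>_pos by (simp add: field_simps)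
      also have "\<dots> \<le> C' * \<epsilon>"
        unfolding C'_def using T(2) \<phi>_le \<epsilon>
        by (intro mult_right_mono add_left_mono divide_left_mono) simp_all
      also have "\<dots> = measure \<nu> A / 2"
        using C' by (simp add: \<epsilon>_def)
      finally have "(C * \<phi> R + 1) * (\<epsilon> * R / \<phi> R) / R \<le> measure \<nu> A / 2" .
      moreover have "0 \<le> \<epsilon> * R / \<phi> R" "0 \<le> C * \<phi> R" using \<epsilon> R_pos \<phi>_pos C by simp_all
      ultimately show "vol_growth G SG (C * \<phi> R) \<le> ?K * vol_growth L SL (c * R)"
        using vol_growth_le_if_small_truncated_means[OF A A_pos c R_pos] means by blast
    qed
  qed
  with c K show ?thesis by (rule that)
qed

end

lemma fin_gen_induced_actionI:
  assumes G: "fin_gen_group G SG" and L: "fin_gen_group L SL"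
    and coupling: "me_coupling G L M aG aL XG XL"
  shows "fin_gen_induced_action G L M aG aL XL SG SL"
proof -
  interpret G: fin_gen_group G SG by (rule G)
  interpret L: fin_gen_group L SL by (rule L)
  show ?thesis
    using coupling G.countable_carrier L.countable_carrier unfolding me_coupling_def
    by unfold_locales blast+
qed

theorem theoremD:
  fixes G :: "('g, 'b) monoid_scheme" and L :: "('l, 'c) monoid_scheme"
    and SG :: "'g set" and SL :: "'l set"
    and fG fL :: "real \<Rightarrow> real"
  assumes "group G" and "group L"
    and "fin_gen_set G SG" and "fin_gen_set L SL"
    and "strict_mono_on {0..} fG" and "strict_mono_on {0..} fL"
    and "\<exists>a. {a..} \<subseteq> fG ` {0..}" and "\<exists>a. {a..} \<subseteq> fL ` {0..}"
    and "asym_eq fG (vol_growth G SG)" and "asym_eq fL (vol_growth L SL)"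
    and "finv fG \<in> o[at_top](finv fL)"
    and "\<forall>C>0. (\<lambda>x. finv fG (C * x)) \<in> O[at_top](finv fG)"
    and "\<forall>C>0. (\<lambda>x. finv fG (fL (C * x))) \<in> O[at_top](\<lambda>x. finv fG (fL x))"
  shows "\<not> (\<exists>(M :: 'w::polish_space measure) aG aL XG XL.
            phi_L0_coupling (\<lambda>x. finv fG (fL x)) G L SL M aG aL XG XL)"
proof
  assume "\<exists>(M :: 'w measure) aG aL XG XL.
      phi_L0_coupling (\<lambda>x. finv fG (fL x)) G L SL M aG aL XG XL"
  then obtain M :: "'w measure" and aG aL XG XL where coupling: "me_coupling G L M aG aL XG XL"
    and int: "phi_integrable_cocycle (\<lambda>x. finv fG (fL x)) G L SL M aG aL XL"
    unfolding phi_L0_coupling_def by blast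
  interpret fin_gen_induced_action G L M aG aL XL SG SL
    using assms(1-4) coupling
    by (intro fin_gen_induced_actionI fin_gen_group.intro fin_gen_group_axioms.intro)
  obtain a b where "{a..} \<subseteq> fG ` {0..}" "{b..} \<subseteq> fL ` {0..}" using assms(7,8) by blast
  then interpret growth_function_pair fG a fL b using assms(5,6) by unfold_locales
  obtain T where "mono_on {T..} rate" "0 < T" "0 < rate T" by (rule ex_mono_on_rate)
  moreover have "fund_domain G M aG XG" "0 < emeasure M XL"
    using coupling by (simp_all add: me_coupling_def)
  ultimately obtain c K where "0 < c" "0 < K" and often_le: "\<And>C. 0 < C \<Longrightarrow>
      \<exists>\<^sub>F R in at_top. vol_growth G SG (C * rate R) \<le> K * vol_growth L SL (c * R)"
    using ex_frequently_vol_growth_le int rate_smallo_ident[OF assms(11)] by blast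
  moreover have "asym_le fG (vol_growth G SG)" "asym_le (vol_growth L SL) fL"
    using assms(9,10) by (simp_all add: asym_eq_def)
  ultimately obtain C where "0 < C"
    and "\<forall>\<^sub>F R in at_top. K * vol_growth L SL (c * R) < vol_growth G SG (C * rate R)"
    using ex_eventually_growth_gap G.vol_growth_nonneg assms(12,13) by blast
  then show False using often_le[of C] by (simp add: frequently_def not_le)
qed

end
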